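(* For every nonempty finite set $X\subset\mathbb{R}^d$, every integer $1\le k\le |X|$, and every noise parameter $0\le\varepsilon<1$, let $C$ be the set of $k$ centers returned by $\varepsilon$-noisy $k$-means++ on input $(X,k,\varepsilon)$. Against every adaptive adversary satisfying the noisy sampling rule, $$\mathbf{E}[\varphi(X,C)]\le 8(\ln k+2)\left(\frac{1+\varepsilon}{1-\varepsilon}\right)^4\mathrm{OPT}_k(X).$$ Moreover, for $0\le\varepsilon<1/2$, the additional multiplicative factor satisfies $\left(\frac{1+\varepsilon}{1-\varepsilon}\right)^4\le 1+160\varepsilon$.
   Context: For finite $X\subset\mathbb{R}^d$ and a nonempty finite set of centers $C\subset\mathbb{R}^d$, $\varphi(X,C)=\sum_{x\in X}\min_{c\in C}\|x-c\|^2$, and $\varphi(x,C):=\varphi(\{x\},C)$. The optimal cost is $\mathrm{OPT}_k(X)=\min_{C\subset\mathbb{R}^d,\,|C|=k}\varphi(X,C)$. $\varepsilon$-noisy $k$-means++ ($n=|X|$): in the first round an adversary chooses a probability distribution $q_1$ on $X$ with $q_1(x)\in[(1-\varepsilon)/n,(1+\varepsilon)/n]$ for every $x\in X$; a point $x\sim q_1$ is sampled and $C_1=\{x\}$. Then, for $j=1,\dots,k-1$, the adversary, who may adapt to the whole history so far, chooses a probability distribution $q_{j+1}$ on $X$ satisfying $$(1-\varepsilon)\frac{\varphi(x,C_j)}{\varphi(X,C_j)}\le q_{j+1}(x)\le(1+\varepsilon)\frac{\varphi(x,C_j)}{\varphi(X,C_j)}\quad\text{for every }x\in X;$$ a point $x\sim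 q_{j+1}$ is sampled and $C_{j+1}=C_j\cup\{x\}$. The output is $C=C_k$. (Since the points of $X$ are distinct and $j<k\le|X|$, $\varphi(X,C_j)>0$ whenever it is used.) These constraints on $q_1,\dots,q_k$ are the noisy sampling rule. *)

theory Defs
  imports "HOL-Probability.Probability"
begin

definition kmeans_cost :: "'a::euclidean_space set \<Rightarrow> 'a set \<Rightarrow> real" where
  "kmeans_cost X C = (\<Sum>x\<in>X. Min ((\<lambda>c. (norm (x - c))\<^sup>2) ` C))"

text \<open>The centers range over all sets of exactly \<^term>\<open>k\<close> points of the ambient space, not only
  over subsets of \<^term>\<open>X\<close>.  The costs are nonnegative, so for \<^prop>\<open>k \<ge> 1\<close> the infimum is that of a
  nonempty set of reals bounded below; by compactness it is attained when \<^term>\<open>X\<close> is finite, hence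
  it is the minimum.\<close>

definition opt_cost :: "nat \<Rightarrow> 'a::euclidean_space set \<Rightarrow> real" where
  "opt_cost k X = (INF C\<in>{C. finite C \<and> card C = k}. kmeans_cost X C)"

text \<open>An adaptive adversary maps the list of points sampled so far (most recent first) to the
  distribution used in the next round; on the empty list it yields the distribution of the first
  round.  \<open>sample_history q j\<close> is the distribution of the list of the first \<open>j\<close> samples.\<close>

type_synonym 'a adversary = "'a list \<Rightarrow> 'a pmf"

primrec sample_history :: "'a adversary \<Rightarrow> nat \<Rightarrow> 'a list pmf" where
  "sample_history q 0 = return_pmf []"
| "sample_history q (Suc j) =
     bind_pmf (sample_history q j) (\<lambda>h. map_pmf (\<lambda>x. x # h) (q h))"

definition noisy_kmeanspp :: "'a adversary \<Rightarrow> nat \<Rightarrow> 'a set pmf" where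
  "noisy_kmeanspp q k = map_pmf set (sample_history q k)"

text \<open>Only histories that occur with positive probability are constrained.\<close>

definition noisy_sampling_rule ::
    "real \<Rightarrow> 'a::euclidean_space set \<Rightarrow> nat \<Rightarrow> 'a adversary \<Rightarrow> bool" where
  "noisy_sampling_rule \<epsilon> X k q \<longleftrightarrow>
     (set_pmf (q []) \<subseteq> X \<and>
      (\<forall>x\<in>X. (1 - \<epsilon>) / real (card X) \<le> pmf (q []) x \<and>
             pmf (q []) x \<le> (1 + \<epsilon>) / real (card X))) \<and>
     (\<forall>j\<in>{1..<k}. \<forall>h\<in>set_pmf (sample_history q j).
        set_pmf (q h) \<subseteq> X \<and>
        (\<forall>x\<in>X. (1 - \<epsilon>) * (kmeans_cost {x} (set h) / kmeans_cost X (set h)) \<le> pmf (q h) x \<and>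
               pmf (q h) x \<le> (1 + \<epsilon>) * (kmeans_cost {x} (set h) / kmeans_cost X (set h))))"

end

theory Submission
  imports Defs
begin

text \<open>Let \<open>R = (1 + \<epsilon>) / (1 - \<epsilon>)\<close>, fix \<open>k\<close> centers and split \<open>X\<close> into their cells.  A cell is covered
  once one of its points has been drawn.  As in the analysis of Arthur and Vassilvitskii, a cell
  that is hit costs in expectation at most \<open>8 * R\<close> times its cost for the fixed center, and each
  wasted round (one hitting a covered cell) is charged with the average cost of the uncovered cells.
  Without noise that average is a supermartingale; with noise it is not, because the adversary may
  prefer cheap cells.  It is replaced by
  \<open>V = \<integral> h \<theta> / (h \<theta> + l \<theta>) d\<theta>\<close> over \<open>\<theta> \<ge> 0\<close>, where \<open>h \<theta>\<close> counts the uncovered cells of cost \<open>> \<theta>\<close>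
  and \<open>l \<theta>\<close> those of cost \<open>\<le> \<theta> / R\<close>.  A cell of the first kind is hit at least as likely as one of the
  second kind, so \<open>V\<close> is a supermartingale under noise, and by layer-cake integration it lies between
  the average and \<open>R\<close> times the average.  Since a round is wasted with odds at most \<open>R\<close> times the ratio
  of covered to uncovered cost, the total is at most \<open>8 * R * (1 + R\<^sup>2 * harm (k - 1))\<close> times the cost
  of the fixed centers.\<close>

section \<open>A mean that is robust against noisy removal\<close>

text \<open>At level \<open>\<theta>\<close> only the elements with \<open>\<phi> i > \<theta>\<close> and those with \<open>R * \<phi> i \<le> \<theta>\<close> are counted: even
  under noise each of the former is at least as likely to be drawn as each of the latter, whereas
  nothing can be said about the elements in between.  The value is \<open>0\<close> if neither kind exists.\<close>

definition layer_ratio :: "real \<Rightarrow> ('i \<Rightarrow> real) \<Rightarrow> 'i set \<Rightarrow> real \<Rightarrow> real" where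
  "layer_ratio R \<phi> U \<theta> =
     (\<Sum>i\<in>U. of_bool (\<theta> < \<phi> i)) /
     ((\<Sum>i\<in>U. of_bool (\<theta> < \<phi> i)) + (\<Sum>i\<in>U. of_bool (R * \<phi> i \<le> \<theta>)))"

text \<open>For \<open>R = 1\<close>, finite \<open>U\<close> and nonnegative \<open>\<phi>\<close>
  this is the arithmetic mean, by the layer-cake formula.\<close>

definition layer_mean :: "real \<Rightarrow> ('i \<Rightarrow> real) \<Rightarrow> 'i set \<Rightarrow> real" where
  "layer_mean R \<phi> U = (LINT \<theta>|lborel. indicator {0..} \<theta> * layer_ratio R \<phi> U \<theta>)"

lemma layer_ratio_nonneg: "0 \<le> layer_ratio R \<phi> U \<theta>"
  by (auto simp: layer_ratio_def intro!: divide_nonneg_nonneg add_nonneg_nonneg sum_nonneg)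

lemma layer_ratio_le_1: "layer_ratio R \<phi> U \<theta> \<le> 1"
proof -
  have "x / (x + y) \<le> 1" if "0 \<le> x" "0 \<le> y" for x y :: real
    using that by (cases "x + y = 0") (auto simp: divide_le_eq_1)
  then show ?thesis unfolding layer_ratio_def by (simp add: sum_nonneg)
qed

lemma layer_ratio_measurable [measurable]: "layer_ratio R \<phi> U \<in> borel_measurable borel"
  unfolding layer_ratio_def by measurable

text \<open>The layer-cake formula for a single value; sums of such terms give all integrals
  evaluated below.\<close>

lemma integral_indicator_layer:
  assumes "0 \<le> (c::real)"
  shows "integrable lborel (\<lambda>\<theta>. indicator {0..} \<theta> * of_bool (\<theta> < c) :: real)"
    and "(LINT \<theta>|lborel. indicator {0..} \<theta> * of_bool (\<theta> < c)) = c"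
proof -
  have eq: "(\<lambda>\<theta>. indicator {0..} \<theta> * of_bool (\<theta> < c) :: real) = indicator {0..<c}"
    by (auto simp: indicator_def)
  show "integrable lborel (\<lambda>\<theta>. indicator {0..} \<theta> * of_bool (\<theta> < c) :: real)"
    unfolding eq using assms by (intro integrable_real_indicator) (auto simp: emeasure_lborel_Ico)
  show "(LINT \<theta>|lborel. indicator {0..} \<theta> * of_bool (\<theta> < c)) = c"
    unfolding eq using assms by simp
qed

text \<open>Let \<open>h\<close> and \<open>l\<close> be the two counts in the ratio and let
  \<open>m\<close> count the elements with \<open>\<theta> < R * \<phi> i\<close>. Then
  \<open>h \<le> m\<close> and \<open>m + l = card U\<close>. As \<open>x / (x + l)\<close> grows
  with \<open>x\<close>, the ratio \<open>h / (h + l)\<close> lies between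
  \<open>h / (m + l)\<close> and \<open>m / (m + l)\<close>.\<close>

lemma layer_ratio_bound:
  assumes "finite U" "1 \<le> R" "\<And>i. i \<in> U \<Longrightarrow> 0 \<le> \<phi> i" "0 \<le> \<theta>"
  shows "(\<Sum>i\<in>U. of_bool (\<theta> < \<phi> i)) / real (card U) \<le> layer_ratio R \<phi> U \<theta>"
    and "layer_ratio R \<phi> U \<theta> \<le> (\<Sum>i\<in>U. of_bool (\<theta> < R * \<phi> i)) / real (card U)"
proof -
  define h where "h = (\<Sum>i\<in>U. of_bool (\<theta> < \<phi> i) :: real)"
  define l where "l = (\<Sum>i\<in>U. of_bool (R * \<phi> i \<le> \<theta>) :: real)"
  define m where "m = (\<Sum>i\<in>U. of_bool (\<theta> < R * \<phi> i) :: real)"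
  have nn: "0 \<le> h" "0 \<le> l" unfolding h_def l_def by (auto intro: sum_nonneg)
  have hm: "h \<le> m" unfolding h_def m_def
  proof (intro sum_mono)
    fix i assume "i \<in> U"
    then have "\<phi> i \<le> R * \<phi> i" using assms(2) assms(3)[of i] mult_right_mono[of 1 R "\<phi> i"] by simp
    then show "of_bool (\<theta> < \<phi> i) \<le> (of_bool (\<theta> < R * \<phi> i) :: real)" by simp
  qed
  have lm: "m + l = real (card U)"
    unfolding l_def m_def sum.distrib[symmetric] real_of_card
    by (intro sum.cong) auto
  have r: "layer_ratio R \<phi> U \<theta> = h / (h + l)" by (simp add: layer_ratio_def h_def l_def)
  show "(\<Sum>i\<in>U. of_bool (\<theta> < \<phi> i)) / real (card U) \<le> layer_ratio R \<phi> U \<theta>"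
    unfolding r h_def[symmetric] lm[symmetric] using nn hm
    by (cases "h = 0") (auto intro!: divide_left_mono mult_pos_pos)
  show "layer_ratio R \<phi> U \<theta> \<le> (\<Sum>i\<in>U. of_bool (\<theta> < R * \<phi> i)) / real (card U)"
    unfolding r m_def[symmetric] lm[symmetric] using nn hm
    by (cases "h = 0") (auto simp: divide_simps algebra_simps intro: mult_right_mono[of h m l, simplified mult.commute])
qed

text \<open>The number of elements above \<open>\<theta>\<close> dominates the ratio: where this
  count is 0 so is the ratio, and elsewhere the count is at least 1.\<close>

lemma layer_integrable:
  assumes "finite U" "\<And>i. i \<in> U \<Longrightarrow> 0 \<le> \<phi> i"
  shows "integrable lborel (\<lambda>\<theta>. indicator {0..} \<theta> * layer_ratio R \<phi> U \<theta>)"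
proof (rule Bochner_Integration.integrable_bound)
  show "integrable lborel (\<lambda>\<theta>. \<Sum>i\<in>U. indicator {0..} \<theta> * of_bool (\<theta> < \<phi> i) :: real)"
    using assms by (intro Bochner_Integration.integrable_sum integral_indicator_layer) auto
  have "layer_ratio R \<phi> U \<theta> \<le> (\<Sum>i\<in>U. of_bool (\<theta> < \<phi> i))" for \<theta>
  proof (cases "\<exists>i\<in>U. \<theta> < \<phi> i")
    case True
    then obtain j where j: "j \<in> U" "\<theta> < \<phi> j" by blast
    then have "(1::real) \<le> (\<Sum>i\<in>U. of_bool (\<theta> < \<phi> i))"
      using member_le_sum[of j U "\<lambda>i. of_bool (\<theta> < \<phi> i) :: real"] assms(1) by simp
    then show ?thesis using layer_ratio_le_1[of R \<phi> U \<theta>] by linarith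
  next
    case False
    then have "(\<Sum>i\<in>U. of_bool (\<theta> < \<phi> i) :: real) = 0" by (intro sum.neutral) auto
    then show ?thesis by (simp add: layer_ratio_def)
  qed
  then show "AE \<theta> in lborel. norm (indicator {0..} \<theta> * layer_ratio R \<phi> U \<theta>)
      \<le> norm (\<Sum>i\<in>U. indicator {0..} \<theta> * of_bool (\<theta> < \<phi> i) :: real)"
    by (intro always_eventually)
      (auto simp: indicator_def layer_ratio_nonneg sum_nonneg)
qed measurable

lemma layer_mean_nonneg: "0 \<le> layer_mean R \<phi> U"
  unfolding layer_mean_def by (intro Bochner_Integration.integral_nonneg) (simp add: layer_ratio_nonneg)

text \<open>The pointwise bounds are integrated over \<open>\<theta>\<close>; the layer-cake formula
  turns the counts into the sums of \<open>\<phi>\<close> and of \<open>R * \<phi>\<close>.\<close>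

lemma layer_mean_bounds:
  assumes "finite U" "1 \<le> R" "\<And>i. i \<in> U \<Longrightarrow> 0 \<le> \<phi> i"
  shows "sum \<phi> U / real (card U) \<le> layer_mean R \<phi> U"
    and "layer_mean R \<phi> U \<le> R * (sum \<phi> U / real (card U))"
proof -
  have *: "integrable lborel (\<lambda>\<theta>. indicator {0..} \<theta> * ((\<Sum>i\<in>U. of_bool (\<theta> < f i)) / real (card U)) :: real)"
    "(LINT \<theta>|lborel. indicator {0..} \<theta> * ((\<Sum>i\<in>U. of_bool (\<theta> < f i)) / real (card U)))
      = sum f U / real (card U)"
    if f: "\<And>i. i \<in> U \<Longrightarrow> 0 \<le> f i" for f
  proof -
    have eq: "(\<lambda>\<theta>. indicator {0..} \<theta> * ((\<Sum>i\<in>U. of_bool (\<theta> < f i)) / real (card U)))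
      = (\<lambda>\<theta>. (\<Sum>i\<in>U. indicator {0..} \<theta> * of_bool (\<theta> < f i)) / real (card U))"
      by (simp add: sum_distrib_left fun_eq_iff)
    show "integrable lborel (\<lambda>\<theta>. indicator {0..} \<theta> * ((\<Sum>i\<in>U. of_bool (\<theta> < f i)) / real (card U)) :: real)"
      unfolding eq using f
      by (intro Bochner_Integration.integrable_divide Bochner_Integration.integrable_sum integral_indicator_layer) auto
    show "(LINT \<theta>|lborel. indicator {0..} \<theta> * ((\<Sum>i\<in>U. of_bool (\<theta> < f i)) / real (card U)))
      = sum f U / real (card U)"
      unfolding eq using f
      by (simp add: Bochner_Integration.integral_sum integral_indicator_layer cong: sum.cong)
  qed
  have Rp: "\<And>i. i \<in> U \<Longrightarrow> 0 \<le> R * \<phi> i" using assms by simp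
  have "(LINT \<theta>|lborel. indicator {0..} \<theta> * ((\<Sum>i\<in>U. of_bool (\<theta> < \<phi> i)) / real (card U)))
      \<le> layer_mean R \<phi> U"
    unfolding layer_mean_def using assms(1,3) layer_ratio_bound(1)[OF assms(1,2), of \<phi>]
    by (intro integral_mono *(1) layer_integrable) (auto simp: indicator_def)
  then show "sum \<phi> U / real (card U) \<le> layer_mean R \<phi> U"
    by (subst (asm) *(2)) (use assms(3) in auto)
  have "layer_mean R \<phi> U
      \<le> (LINT \<theta>|lborel. indicator {0..} \<theta> * ((\<Sum>i\<in>U. of_bool (\<theta> < R * \<phi> i)) / real (card U)))"
    unfolding layer_mean_def using assms(1,3) Rp layer_ratio_bound(2)[OF assms(1,2), of \<phi>]
    by (intro integral_mono *(1) layer_integrable) (auto simp: indicator_def)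
  then have "layer_mean R \<phi> U \<le> (\<Sum>i\<in>U. R * \<phi> i) / real (card U)"
    by (subst (asm) *(2)) (use Rp in auto)
  then show "layer_mean R \<phi> U \<le> R * (sum \<phi> U / real (card U))"
    by (simp add: sum_distrib_left)
qed

text \<open>Larger values raise the count \<open>h\<close> and lower the count \<open>l\<close>, and
  both changes raise \<open>h / (h + l)\<close>. Needed because a new center lowers all cell
  costs.\<close>

lemma layer_mean_mono:
  assumes "finite U" "0 \<le> R" "\<And>i. i \<in> U \<Longrightarrow> 0 \<le> \<phi> i" "\<And>i. i \<in> U \<Longrightarrow> \<phi> i \<le> \<psi> i"
  shows "layer_mean R \<phi> U \<le> layer_mean R \<psi> U"
proof -
  have "layer_ratio R \<phi> U \<theta> \<le> layer_ratio R \<psi> U \<theta>" for \<theta>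
  proof -
    define h h' where "h = (\<Sum>i\<in>U. of_bool (\<theta> < \<phi> i) :: real)" and "h' = (\<Sum>i\<in>U. of_bool (\<theta> < \<psi> i) :: real)"
    define l l' where "l = (\<Sum>i\<in>U. of_bool (R * \<phi> i \<le> \<theta>) :: real)" and "l' = (\<Sum>i\<in>U. of_bool (R * \<psi> i \<le> \<theta>) :: real)"
    have h: "h \<le> h'" unfolding h_def h'_def using assms(4) by (intro sum_mono) fastforce
    have l: "l' \<le> l" unfolding l_def l'_def
    proof (intro sum_mono)
      fix i assume "i \<in> U"
      then have "R * \<phi> i \<le> R * \<psi> i" using assms by (simp add: mult_left_mono)
      then show "of_bool (R * \<psi> i \<le> \<theta>) \<le> (of_bool (R * \<phi> i \<le> \<theta>) :: real)" by simp
    qed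
    have nn: "0 \<le> h" "0 \<le> l'" unfolding h_def l'_def by (auto intro: sum_nonneg)
    have "h * l' \<le> h' * l" using h l nn by (intro mult_mono) auto
    then have "h / (h + l) \<le> h' / (h' + l')"
      using h l nn by (cases "h = 0") (auto simp: divide_simps algebra_simps)
    then show ?thesis by (simp add: layer_ratio_def h_def h'_def l_def l'_def)
  qed
  moreover have "\<And>i. i \<in> U \<Longrightarrow> 0 \<le> \<psi> i" using assms(3,4) by force
  ultimately show ?thesis unfolding layer_mean_def using assms
    by (intro integral_mono layer_integrable) (auto simp: indicator_def)
qed

text \<open>Removing an element above \<open>\<theta>\<close> cannot raise the ratio, removing one
  with \<open>R * \<phi> i \<le> \<theta>\<close> cannot lower it, and each element of the first
  kind has at least the weight of each of the second.\<close>

lemma layer_ratio_removal: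
  assumes U: "finite U" and q: "\<And>i. i \<in> U \<Longrightarrow> 0 \<le> q i"
    and qle: "\<And>i j. i \<in> U \<Longrightarrow> j \<in> U \<Longrightarrow> R * \<phi> i \<le> \<phi> j \<Longrightarrow> q i \<le> q j"
    and R: "1 \<le> R" and \<phi>: "\<And>i. i \<in> U \<Longrightarrow> 0 \<le> \<phi> i"
  shows "(\<Sum>i\<in>U. q i * layer_ratio R \<phi> (U - {i}) \<theta>) \<le> sum q U * layer_ratio R \<phi> U \<theta>"
proof -
  define a where "a i = (of_bool (\<theta> < \<phi> i) :: real)" for i
  define b where "b i = (of_bool (R * \<phi> i \<le> \<theta>) :: real)" for i
  define h l where "h = sum a U" and "l = sum b U"
  have eq: "layer_ratio R \<phi> U \<theta> = h / (h + l)"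
    by (simp add: layer_ratio_def h_def l_def a_def b_def)
  have eqi: "layer_ratio R \<phi> (U - {i}) \<theta> = (h - a i) / (h - a i + (l - b i))" if "i \<in> U" for i
    using U that unfolding layer_ratio_def a_def[symmetric] b_def[symmetric] h_def l_def
    by (simp add: sum_diff1)
  have ab: "a i = 0 \<or> a i = 1" "b i = 0 \<or> b i = 1" for i by (auto simp: a_def b_def)
  have nn: "0 \<le> h" "0 \<le> l" unfolding h_def l_def a_def b_def by (auto intro: sum_nonneg)
  have int: "h = real (card {i\<in>U. \<theta> < \<phi> i})" "l = real (card {i\<in>U. R * \<phi> i \<le> \<theta>})"
    using U by (simp_all add: h_def l_def a_def b_def of_bool_def sum.If_cases Int_def)
  \<comment> \<open>Both counts are integers, so if both are positive then
    \<open>h + l \<ge> 2\<close>, and one element can be removed without a zero denominator.\<close>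
  consider "h = 0" | "h > 0" "l = 0" | "h \<ge> 1" "l \<ge> 1" 
    using int nn by (cases "card {i\<in>U. \<theta> < \<phi> i}"; cases "card {i\<in>U. R * \<phi> i \<le> \<theta>}") auto
  then show ?thesis
  proof cases
    case 1
    then have "a i = 0" if "i \<in> U" for i
      using U that sum_nonneg_eq_0_iff[of U a] by (auto simp: h_def a_def)
    then show ?thesis using 1 by (simp add: eq eqi)
  next
    case 2
    then have "layer_ratio R \<phi> U \<theta> = 1" by (simp add: eq)
    then show ?thesis using q layer_ratio_le_1
      by (auto intro!: sum_mono mult_left_le)
  next
    case 3
    define n where "n = h + l"
    have n: "n \<ge> 2" using 3 by (simp add: n_def)
    \<comment> \<open>As \<open>\<phi> i \<le> R * \<phi> i\<close>, no element enters both
      counts.\<close>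
    have excl: "a i * b i = 0" if "i \<in> U" for i
      using mult_right_mono[OF R \<phi>[OF that]] by (auto simp: a_def b_def)
    \<comment> \<open>The exact change on removal: \<open>- l / (n * (n - 1))\<close> for an element
      of the first kind, \<open>h / (n * (n - 1))\<close> for one of the second, zero for the
      rest.\<close>
    have "q i * layer_ratio R \<phi> (U - {i}) \<theta> = q i * h / n + (h * (b i * q i) - l * (a i * q i)) / (n * (n - 1))"
      if "i \<in> U" for i
    proof -
      have "layer_ratio R \<phi> (U - {i}) \<theta> = h / n + (h * b i - l * a i) / (n * (n - 1))"
      proof -
        have l: "l = n - h" and n0: "n \<noteq> 0" "n - 1 \<noteq> 0" using n by (auto simp: n_def)
        have "h / (n - 1) = h / n + h / (n * (n - 1))"
          "(h - 1) / (n - 1) = h / n + (h - n) / (n * (n - 1))"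
          using n0 by (simp_all add: divide_simps) (simp_all add: algebra_simps)
        moreover have "h - a i + (n - h - b i) = n - a i - b i" by simp
        ultimately show ?thesis using ab[of i] excl[OF that] unfolding eqi[OF that] l
          by (elim disjE) simp_all
      qed
      then show ?thesis by (simp add: field_simps)
    qed
    then have "(\<Sum>i\<in>U. q i * layer_ratio R \<phi> (U - {i}) \<theta>)
      = (\<Sum>i\<in>U. q i * h / n + (h * (b i * q i) - l * (a i * q i)) / (n * (n - 1)))"
      by (intro sum.cong) auto
    also have "\<dots> = sum q U * h / n + (h * (\<Sum>i\<in>U. b i * q i) - l * (\<Sum>i\<in>U. a i * q i)) / (n * (n - 1))"
      unfolding sum.distrib sum_divide_distrib[symmetric] sum_subtractf
        sum_distrib_left[symmetric] sum_distrib_right[symmetric] ..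
    also have "\<dots> \<le> sum q U * h / n"
    proof -
      \<comment> \<open>Compare pairwise: a high \<open>j\<close> and a low \<open>i\<close> satisfy
        \<open>R * \<phi> i \<le> \<theta> < \<phi> j\<close>, hence
        \<open>q i \<le> q j\<close>.\<close>
      have "h * (\<Sum>i\<in>U. b i * q i) = (\<Sum>j\<in>U. \<Sum>i\<in>U. a j * (b i * q i))"
        unfolding h_def by (rule sum_product)
      also have "\<dots> \<le> (\<Sum>j\<in>U. \<Sum>i\<in>U. (a j * q j) * b i)"
      proof (intro sum_mono)
        fix i j assume ij: "i \<in> U" "j \<in> U"
        show "a j * (b i * q i) \<le> (a j * q j) * b i"
          using qle[OF ij] by (auto simp: a_def b_def)
      qed
      also have "\<dots> = (\<Sum>i\<in>U. a i * q i) * l"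
        unfolding l_def by (rule sum_product[symmetric])
      finally show ?thesis using n by (simp add: divide_nonpos_pos mult.commute)
    qed
    finally show ?thesis by (simp add: eq n_def)
  qed
qed

text \<open>The pointwise removal inequality, integrated over \<open>\<theta>\<close>. With
  \<open>q\<close> the hitting probabilities of the uncovered cells it becomes the supermartingale
  property of the envelope.\<close>

lemma layer_mean_removal:
  assumes U: "finite U" and q: "\<And>i. i \<in> U \<Longrightarrow> 0 \<le> q i"
    and qle: "\<And>i j. i \<in> U \<Longrightarrow> j \<in> U \<Longrightarrow> R * \<phi> i \<le> \<phi> j \<Longrightarrow> q i \<le> q j"
    and R: "1 \<le> R" and \<phi>: "\<And>i. i \<in> U \<Longrightarrow> 0 \<le> \<phi> i"
  shows "(\<Sum>i\<in>U. q i * layer_mean R \<phi> (U - {i})) \<le> sum q U * layer_mean R \<phi> U"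
proof -
  have i: "integrable lborel (\<lambda>\<theta>. indicator {0..} \<theta> * layer_ratio R \<phi> V \<theta>)" if "V \<subseteq> U" for V
    using that finite_subset[OF that U] \<phi> by (intro layer_integrable) auto
  have "(\<Sum>i\<in>U. q i * layer_mean R \<phi> (U - {i}))
    = (LINT \<theta>|lborel. (\<Sum>j\<in>U. q j * (indicator {0..} \<theta> * layer_ratio R \<phi> (U - {j}) \<theta>)))"
    unfolding layer_mean_def by (simp add: Bochner_Integration.integral_sum i)
  also have "\<dots> \<le> (LINT \<theta>|lborel. sum q U * (indicator {0..} \<theta> * layer_ratio R \<phi> U \<theta>))"
  proof (intro integral_mono Bochner_Integration.integrable_sum integrable_mult_right i)
    fix \<theta>
    show "(\<Sum>j\<in>U. q j * (indicator {0..} \<theta> * layer_ratio R \<phi> (U - {j}) \<theta>))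
      \<le> sum q U * (indicator {0..} \<theta> * layer_ratio R \<phi> U \<theta>)"
      using layer_ratio_removal[OF assms, where \<theta>=\<theta>] by (auto simp: indicator_def)
  qed auto
  finally show ?thesis by (simp add: layer_mean_def)
qed

section \<open>Clustering costs\<close>

lemma kmeans_cost_eq_sum: "kmeans_cost A C = (\<Sum>x\<in>A. kmeans_cost {x} C)"
  by (simp add: kmeans_cost_def)

lemma kmeans_cost_nonneg:
  assumes "finite C" "C \<noteq> {}"
  shows "0 \<le> kmeans_cost A C"
  unfolding kmeans_cost_def using assms by (intro sum_nonneg) (auto simp: Min_ge_iff)

lemma kmeans_cost_point_le:
  assumes "finite C" "c \<in> C"
  shows "kmeans_cost {x} C \<le> (norm (x - c))\<^sup>2"
  using assms by (simp add: kmeans_cost_def)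

lemma kmeans_cost_point_attained:
  assumes "finite C" "C \<noteq> {}"
  obtains c where "c \<in> C" "kmeans_cost {x} C = (norm (x - c))\<^sup>2"
proof -
  have "kmeans_cost {x} C \<in> (\<lambda>c. (norm (x - c))\<^sup>2) ` C"
    unfolding kmeans_cost_def using assms by (simp del: image_iff)
  then show thesis using that by blast
qed

lemma kmeans_cost_insert_le:
  assumes "finite C" "C \<noteq> {}"
  shows "kmeans_cost A (insert a C) \<le> kmeans_cost A C"
  unfolding kmeans_cost_def using assms by (intro sum_mono Min_antimono) auto

lemma power2_norm_diff_le:
  fixes x y z :: "'a::real_inner"
  shows "(norm (x - z))\<^sup>2 \<le> 2 * (norm (y - z))\<^sup>2 + 2 * (norm (y - x))\<^sup>2"
proof -
  have "norm (x - z) \<le> norm (y - z) + norm (y - x)"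
    using norm_triangle_ineq4[of "y - z" "y - x"] by simp
  then have "(norm (x - z))\<^sup>2 \<le> (norm (y - z) + norm (y - x))\<^sup>2"
    by (intro power_mono) auto
  also have "\<dots> \<le> 2 * (norm (y - z))\<^sup>2 + 2 * (norm (y - x))\<^sup>2"
    using sum_squares_bound[of "norm (y - z)" "norm (y - x)"] by (simp add: power2_sum)
  finally show ?thesis .
qed

text \<open>In the expansion around \<open>c\<close> the mixed terms add up to minus twice the
  squared norm of \<open>\<Sum>x\<in>A. x - c\<close>, which is dropped.\<close>

lemma sum_pairwise_dist_le:
  fixes c :: "'a::real_inner"
  shows "(\<Sum>a\<in>A. \<Sum>x\<in>A. (norm (x - a))\<^sup>2) \<le> 2 * real (card A) * (\<Sum>x\<in>A. (norm (x - c))\<^sup>2)"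
proof -
  have e: "(norm (x - a))\<^sup>2 = (norm (x - c))\<^sup>2 + (norm (a - c))\<^sup>2 - 2 * ((x - c) \<bullet> (a - c))" for x a
    by (simp add: power2_norm_eq_inner algebra_simps inner_commute)
  have i: "(\<Sum>a\<in>A. \<Sum>x\<in>A. (x - c) \<bullet> (a - c)) = (\<Sum>x\<in>A. x - c) \<bullet> (\<Sum>a\<in>A. a - c)"
    unfolding inner_sum_left inner_sum_right ..
  have "(\<Sum>a\<in>A. \<Sum>x\<in>A. (norm (x - a))\<^sup>2)
    = 2 * real (card A) * (\<Sum>x\<in>A. (norm (x - c))\<^sup>2) - 2 * (\<Sum>a\<in>A. \<Sum>x\<in>A. (x - c) \<bullet> (a - c))"
    by (subst e) (simp add: sum_subtractf sum.distrib flip: sum_distrib_left sum_distrib_right)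
  then show ?thesis unfolding i by simp
qed

text \<open>The Arthur-Vassilvitskii bound for drawing a point of \<open>A\<close> with probability
  proportional to its current cost, multiplied by the normalising constant
  \<open>kmeans_cost A C\<close> so that no division occurs.\<close>

lemma D2_seeding_cost:
  fixes c :: "'a::euclidean_space"
  assumes A: "finite A" and C: "finite C" "C \<noteq> {}"
  shows "(\<Sum>a\<in>A. kmeans_cost {a} C * kmeans_cost A (insert a C))
    \<le> 8 * kmeans_cost A C * (\<Sum>x\<in>A. (norm (x - c))\<^sup>2)"
proof (cases "A = {}")
  case False
  define m where "m = real (card A)"
  have m: "m > 0" using False A by (simp add: m_def card_gt_0_iff)
  define N where "N a = (\<Sum>x\<in>A. (norm (x - a))\<^sup>2)" for a
  define D where "D = kmeans_cost A C"
  define g where "g a = kmeans_cost A (insert a C)" for a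
  have D0: "0 \<le> D" and g0: "0 \<le> g a" for a
    using C by (auto simp: D_def g_def kmeans_cost_nonneg)
  have gD: "g a \<le> D" for a unfolding g_def D_def using C by (rule kmeans_cost_insert_le)
  have gN: "g a \<le> N a" for a
    unfolding g_def N_def kmeans_cost_eq_sum[of A "insert a C"] using C
    by (intro sum_mono kmeans_cost_point_le) auto
  \<comment> \<open>For each \<open>x\<close>, go from \<open>a\<close> through \<open>x\<close> to
    the center nearest to \<open>x\<close>; then sum over all \<open>x\<close> in
    \<open>A\<close>.\<close>
  have mD: "m * kmeans_cost {a} C \<le> 2 * D + 2 * N a" for a
  proof -
    have "kmeans_cost {a} C \<le> 2 * kmeans_cost {x} C + 2 * (norm (x - a))\<^sup>2" for x
    proof -
      obtain z where z: "z \<in> C" "kmeans_cost {x} C = (norm (x - z))\<^sup>2"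
        using kmeans_cost_point_attained[OF C] by blast
      have "kmeans_cost {a} C \<le> (norm (a - z))\<^sup>2" using C(1) z(1) by (rule kmeans_cost_point_le)
      also have "\<dots> \<le> 2 * (norm (x - z))\<^sup>2 + 2 * (norm (x - a))\<^sup>2" by (rule power2_norm_diff_le)
      finally show ?thesis using z by simp
    qed
    then have "(\<Sum>x\<in>A. kmeans_cost {a} C) \<le> (\<Sum>x\<in>A. 2 * kmeans_cost {x} C + 2 * (norm (x - a))\<^sup>2)"
      by (rule sum_mono)
    then show ?thesis
      by (simp add: m_def D_def N_def kmeans_cost_eq_sum[of A C] sum.distrib sum_distrib_left)
  qed
  have "m * (kmeans_cost {a} C * g a) \<le> 4 * D * N a" for a
  proof -
    have "m * kmeans_cost {a} C * g a \<le> (2 * D + 2 * N a) * g a"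
      using mD g0 by (intro mult_right_mono)
    \<comment> \<open>Next to the factor \<open>D\<close> the new cost \<open>g a\<close> is bounded
      by \<open>N a\<close>, next to \<open>N a\<close> it is bounded by \<open>D\<close>.\<close>
    also have "\<dots> \<le> 2 * (D * N a) + 2 * (N a * D)"
      using mult_left_mono[OF gN[of a] D0] mult_left_mono[OF gD[of a] order_trans[OF g0 gN], of a]
      by (simp add: algebra_simps)
    finally show ?thesis by (simp add: mult_ac)
  qed
  then have "m * (\<Sum>a\<in>A. kmeans_cost {a} C * g a) \<le> (\<Sum>a\<in>A. 4 * D * N a)"
    unfolding sum_distrib_left by (rule sum_mono)
  also have "\<dots> = 4 * D * (\<Sum>a\<in>A. N a)" by (simp add: sum_distrib_left)
  \<comment> \<open>Summing \<open>N a\<close> over \<open>a\<close> contributes the last factor 2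
    of the constant 8.\<close>
  also have "\<dots> \<le> 4 * D * (2 * m * N c)"
    using D0 sum_pairwise_dist_le[of A c] by (intro mult_left_mono) (auto simp: N_def m_def)
  also have "\<dots> = m * (8 * D * N c)" by simp
  finally show ?thesis using m by (simp add: D_def g_def N_def)
qed simp

section \<open>Estimates for the noise ratio and harmonic numbers\<close>

definition noise_ratio :: "real \<Rightarrow> real" where
  "noise_ratio \<epsilon> = (1 + \<epsilon>) / (1 - \<epsilon>)"

lemma noise_ratio_ge_1: "0 \<le> \<epsilon> \<Longrightarrow> \<epsilon> < 1 \<Longrightarrow> 1 \<le> noise_ratio \<epsilon>"
  by (simp add: noise_ratio_def)

text \<open>Linearise with \<open>\<epsilon> * \<epsilon> \<le> \<epsilon> / 2\<close> three times:
  the ratio is at most \<open>1 + 4 * \<epsilon>\<close>, its square at most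
  \<open>1 + 16 * \<epsilon>\<close>, its fourth power at most
  \<open>1 + 160 * \<epsilon>\<close>.\<close>

lemma noise_ratio_power4_le:
  fixes \<epsilon> :: real
  assumes "0 \<le> \<epsilon>" "\<epsilon> < 1 / 2"
  shows "((1 + \<epsilon>) / (1 - \<epsilon>)) ^ 4 \<le> 1 + 160 * \<epsilon>"
proof -
  have "0 \<le> \<epsilon> * (1 / 2 - \<epsilon>)" using assms by (intro mult_nonneg_nonneg) auto
  then have 2: "\<epsilon> * \<epsilon> \<le> \<epsilon> / 2" by (simp add: right_diff_distrib)
  have "1 + \<epsilon> \<le> (1 + 4 * \<epsilon>) * (1 - \<epsilon>)"
    using 2 by (simp add: ring_distribs)
  then have "(1 + \<epsilon>) / (1 - \<epsilon>) \<le> 1 + 4 * \<epsilon>"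
    using assms by (subst pos_divide_le_eq) auto
  then have "((1 + \<epsilon>) / (1 - \<epsilon>)) ^ 4 \<le> (1 + 4 * \<epsilon>) ^ 4"
    using assms by (intro power_mono) auto
  also have "\<dots> = ((1 + 4 * \<epsilon>) * (1 + 4 * \<epsilon>)) ^ 2" by (simp add: power_mult_distrib flip: power_add)
  also have "\<dots> \<le> (1 + 16 * \<epsilon>) ^ 2"
    using 2 assms by (intro power_mono) (auto simp: ring_distribs)
  also have "\<dots> \<le> 1 + 160 * \<epsilon>"
    using 2 by (simp add: power2_eq_square ring_distribs)
  finally show ?thesis .
qed

text \<open>The sequence \<open>harm n - ln n\<close>, which tends to the Euler-Mascheroni constant,
  decreases from its value 1 at \<open>n = 1\<close>.\<close>

lemma harm_le_ln_plus_1: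
  assumes "1 \<le> n"
  shows "(harm n :: real) \<le> ln (real n) + 1"
proof -
  have "(harm 1 :: real) = 1" by (simp add: harm_def)
  then show ?thesis using euler_mascheroni_sequence_decreasing[of 1 n] assms by simp
qed

section \<open>The potential of noisy seeding\<close>

lemma noisy_sampling_rule_later:
  assumes "noisy_sampling_rule \<epsilon> X k q" "1 \<le> j" "j < k" "h \<in> set_pmf (sample_history q j)"
  shows "set_pmf (q h) \<subseteq> X"
    and "x \<in> X \<Longrightarrow> (1 - \<epsilon>) * (kmeans_cost {x} (set h) / kmeans_cost X (set h)) \<le> pmf (q h) x"
    and "x \<in> X \<Longrightarrow> pmf (q h) x \<le> (1 + \<epsilon>) * (kmeans_cost {x} (set h) / kmeans_cost X (set h))"
proof -
  have "j \<in> {1..<k}" using assms(2,3) by simp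
  then have "set_pmf (q h) \<subseteq> X \<and>
        (\<forall>x\<in>X. (1 - \<epsilon>) * (kmeans_cost {x} (set h) / kmeans_cost X (set h)) \<le> pmf (q h) x \<and>
               pmf (q h) x \<le> (1 + \<epsilon>) * (kmeans_cost {x} (set h) / kmeans_cost X (set h)))"
    using assms(1,4) unfolding noisy_sampling_rule_def by blast
  then show "set_pmf (q h) \<subseteq> X"
    and "x \<in> X \<Longrightarrow> (1 - \<epsilon>) * (kmeans_cost {x} (set h) / kmeans_cost X (set h)) \<le> pmf (q h) x"
    and "x \<in> X \<Longrightarrow> pmf (q h) x \<le> (1 + \<epsilon>) * (kmeans_cost {x} (set h) / kmeans_cost X (set h))"
    by blast+
qed

text \<open>The map \<open>s\<close> is arbitrary here and is later taken to send a point to a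
  nearest fixed center. Its values serve both as labels of the cells and as their centers.\<close>

locale noisy_seeding =
  fixes X :: "'a::euclidean_space set" and s :: "'a \<Rightarrow> 'a" and \<epsilon> :: real
  assumes finite_X: "finite X" and eps_nonneg: "0 \<le> \<epsilon>" and eps_less_1: "\<epsilon> < 1"
begin

abbreviation R :: real where "R \<equiv> noise_ratio \<epsilon>"

definition cell :: "'a \<Rightarrow> 'a set" where
  "cell i = {x\<in>X. s x = i}"

definition center_cost :: "'a \<Rightarrow> real" where
  "center_cost i = (\<Sum>x\<in>cell i. (norm (x - i))\<^sup>2)"

definition uncovered :: "'a set \<Rightarrow> 'a set" where
  "uncovered C = s ` X - s ` C"

text \<open>Pre-charges every uncovered cell with the bound on its expected cost once it is hit; in
  expectation this quantity does not grow when a new center is drawn.\<close>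

definition settled_cost :: "'a set \<Rightarrow> real" where
  "settled_cost C = (\<Sum>i\<in>s ` C. kmeans_cost (cell i) C) + 8 * R * (\<Sum>i\<in>uncovered C. center_cost i)"

text \<open>The set of cells is a separate argument, so that one cell can be removed while the costs
  stay those for the old centers.\<close>

definition envelope :: "'a set \<Rightarrow> 'a set \<Rightarrow> real" where
  "envelope C U = layer_mean R (\<lambda>i. kmeans_cost (cell i) C) U"

text \<open>With \<open>t\<close> rounds left, at least \<open>card (uncovered C) - t\<close> cells stay uncovered; truncated
  subtraction is intended.\<close>

definition potential :: "nat \<Rightarrow> 'a set \<Rightarrow> real" where
  "potential t C = settled_cost C * (1 + R\<^sup>2 * harm (card (uncovered C)))
     + real (card (uncovered C) - t) * envelope C (uncovered C)"

lemma R_ge_1: "1 \<le> R"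
  using eps_nonneg eps_less_1 by (rule noise_ratio_ge_1)

lemma one_plus_eps: "1 + \<epsilon> = (1 - \<epsilon>) * R"
  using eps_less_1 by (simp add: noise_ratio_def)

lemma finite_cell: "finite (cell i)" and finite_uncovered: "finite (uncovered C)"
  using finite_X by (auto simp: cell_def uncovered_def)

lemma center_cost_nonneg: "0 \<le> center_cost i"
  by (simp add: center_cost_def sum_nonneg)

lemma harm_factor_ge_1: "1 \<le> 1 + R\<^sup>2 * (harm n :: real)"
  using R_ge_1 by (simp add: harm_nonneg)

lemma sum_cells:
  fixes f :: "'a \<Rightarrow> real"
  assumes "C \<subseteq> X"
  shows "(\<Sum>x\<in>X. f x)
    = (\<Sum>i\<in>s ` C. \<Sum>x\<in>cell i. f x) + (\<Sum>i\<in>uncovered C. \<Sum>x\<in>cell i. f x)"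
proof -
  have "(\<Sum>x\<in>X. f x) = (\<Sum>i\<in>s ` X. \<Sum>x\<in>cell i. f x)"
    unfolding cell_def using finite_X by (intro sum.group[symmetric]) auto
  also have "\<dots> = (\<Sum>i\<in>s ` C. \<Sum>x\<in>cell i. f x) + (\<Sum>i\<in>uncovered C. \<Sum>x\<in>cell i. f x)"
    unfolding uncovered_def using finite_X assms
    by (subst sum.subset_diff[of "s ` C"]) (auto simp: add.commute)
  finally show ?thesis .
qed

lemma uncovered_insert: "uncovered (insert x C) = uncovered C - {s x}"
  by (auto simp: uncovered_def)

text \<open>The covered cells are paid by the settled cost, whose factor is at least 1. With no
  round left the envelope has coefficient \<open>card (uncovered C)\<close> and dominates the
  average uncovered cost, so it pays for the rest.\<close>

lemma cost_le_potential_0: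
  assumes C: "finite C" "C \<noteq> {}" "C \<subseteq> X"
  shows "kmeans_cost X C \<le> potential 0 C"
proof -
  let ?U = "uncovered C"
  have nn: "0 \<le> kmeans_cost A C" for A using C by (simp add: kmeans_cost_nonneg)
  have "(\<Sum>i\<in>s ` C. kmeans_cost (cell i) C) \<le> settled_cost C"
    using R_ge_1 by (simp add: settled_cost_def sum_nonneg center_cost_nonneg)
  moreover have "0 \<le> settled_cost C"
    using R_ge_1 by (auto simp: settled_cost_def sum_nonneg center_cost_nonneg nn intro!: add_nonneg_nonneg)
  ultimately have 1: "(\<Sum>i\<in>s ` C. kmeans_cost (cell i) C)
      \<le> settled_cost C * (1 + R\<^sup>2 * harm (card ?U))"
    using mult_left_mono[OF harm_factor_ge_1] by (smt (verit))
  have "(\<Sum>i\<in>?U. kmeans_cost (cell i) C) / real (card ?U) \<le> envelope C ?U"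
    unfolding envelope_def using finite_uncovered R_ge_1 nn by (intro layer_mean_bounds) auto
  then have 2: "(\<Sum>i\<in>?U. kmeans_cost (cell i) C) \<le> real (card ?U) * envelope C ?U"
    using finite_uncovered[of C] by (cases "?U = {}") (auto simp: divide_le_eq mult.commute card_gt_0_iff)
  show ?thesis
    using 1 2 C sum_cells[of C "\<lambda>x. kmeans_cost {x} C"]
    by (simp add: potential_def kmeans_cost_eq_sum[of _ C, symmetric])
qed

section \<open>Behaviour of the potential when a center is added\<close>

lemma settled_cost_insert_covered:
  assumes "finite C" "C \<noteq> {}" "s x \<in> s ` C"
  shows "settled_cost (insert x C) \<le> settled_cost C"
proof -
  have "s ` insert x C = s ` C" "uncovered (insert x C) = uncovered C"
    using assms by (auto simp: uncovered_def)
  then show ?thesis unfolding settled_cost_def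
    using assms by (auto intro!: sum_mono kmeans_cost_insert_le)
qed

text \<open>The hit cell exchanges its pre-charge for its actual cost; the other covered cells only
  get cheaper.\<close>

lemma settled_cost_insert_uncovered:
  assumes "finite C" "C \<noteq> {}" "s x \<in> uncovered C"
  shows "settled_cost (insert x C)
    \<le> settled_cost C - 8 * R * center_cost (s x) + kmeans_cost (cell (s x)) (insert x C)"
proof -
  have "s x \<notin> s ` C" using assms by (simp add: uncovered_def)
  then have "settled_cost (insert x C) = kmeans_cost (cell (s x)) (insert x C)
      + (\<Sum>i\<in>s ` C. kmeans_cost (cell i) (insert x C))
      + 8 * R * ((\<Sum>i\<in>uncovered C. center_cost i) - center_cost (s x))"
    using assms finite_uncovered by (simp add: settled_cost_def uncovered_insert sum_diff1)
  also have "(\<Sum>i\<in>s ` C. kmeans_cost (cell i) (insert x C)) \<le> (\<Sum>i\<in>s ` C. kmeans_cost (cell i) C)"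
    using assms by (intro sum_mono kmeans_cost_insert_le)
  finally show ?thesis by (simp add: settled_cost_def algebra_simps)
qed

lemma envelope_insert_le:
  assumes "finite C" "C \<noteq> {}" "finite U"
  shows "envelope (insert x C) U \<le> envelope C U"
  unfolding envelope_def using assms R_ge_1
  by (intro layer_mean_mono) (auto intro: kmeans_cost_nonneg kmeans_cost_insert_le)

text \<open>A hit replaces a pre-charge by a cost of no larger expectation and lowers the harmonic
  factor; a miss adds at most one copy of the envelope. The expected saving in the harmonic factor
  pays for the expected number of added copies.\<close>

lemma potential_step:
  assumes C: "finite C" "C \<noteq> {}" "C \<subseteq> X"
    and p_nonneg: "\<And>x. x \<in> X \<Longrightarrow> 0 \<le> p x" and p_sum: "(\<Sum>x\<in>X. p x) = 1"
    and p_lower: "\<And>x. x \<in> X \<Longrightarrow> (1 - \<epsilon>) * (kmeans_cost {x} C / kmeans_cost X C) \<le> p x"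
    and p_upper: "\<And>x. x \<in> X \<Longrightarrow> p x \<le> (1 + \<epsilon>) * (kmeans_cost {x} C / kmeans_cost X C)"
  shows "(\<Sum>x\<in>X. p x * potential t (insert x C)) \<le> potential (Suc t) C"
proof -
  define U where "U = uncovered C"
  define u where "u = card U"
  define m where "m = real (u - Suc t)"
  define a where "a = settled_cost C"
  define V where "V = envelope C U"
  define \<Phi> where "\<Phi> = kmeans_cost X C"
  define cost where "cost i = kmeans_cost (cell i) C" for i
  define q where "q i = (\<Sum>x\<in>cell i. p x)" for i
  define hf where "hf n = 1 + R\<^sup>2 * (harm n :: real)" for n
  define q\<^sub>0 where "q\<^sub>0 = (\<Sum>i\<in>s ` C. q i)"
  define q\<^sub>U where "q\<^sub>U = (\<Sum>i\<in>U. q i)"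
  have finU: "finite U" by (simp add: U_def finite_uncovered)
  have nn: "0 \<le> kmeans_cost A C" for A using C by (simp add: kmeans_cost_nonneg)
  have cost_nn: "0 \<le> cost i" for i by (simp add: cost_def nn)
  \<comment> \<open>If \<open>\<Phi>\<close> were 0, the quotients by it would be 0 and the
    estimates below would still be valid.\<close>
  have \<Phi>: "0 \<le> \<Phi>" by (simp add: \<Phi>_def nn)
  have q_nn: "0 \<le> q i" for i unfolding q_def using p_nonneg by (auto intro!: sum_nonneg simp: cell_def)
  have V_nn: "0 \<le> V" by (simp add: V_def envelope_def layer_mean_nonneg)
  have hf_ge: "1 \<le> hf n" for n unfolding hf_def by (rule harm_factor_ge_1)
  have a_ge: "(\<Sum>i\<in>s ` C. cost i) \<le> a"
    using R_ge_1 by (simp add: a_def cost_def settled_cost_def sum_nonneg center_cost_nonneg)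
  then have a_nn: "0 \<le> a" using cost_nn by (meson order_trans sum_nonneg)
  have m_nn: "0 \<le> m" by (simp add: m_def)
  have total: "q\<^sub>0 + q\<^sub>U = 1"
    using sum_cells[OF C(3), of p] p_sum by (simp add: q\<^sub>0_def q\<^sub>U_def q_def U_def)
  have q_lower: "(1 - \<epsilon>) * (cost i / \<Phi>) \<le> q i" for i
  proof -
    have "(1 - \<epsilon>) * (cost i / \<Phi>) = (\<Sum>x\<in>cell i. (1 - \<epsilon>) * (kmeans_cost {x} C / \<Phi>))"
      unfolding cost_def kmeans_cost_eq_sum[of "cell i"]
      by (simp add: sum_distrib_left sum_divide_distrib)
    also have "\<dots> \<le> q i" unfolding q_def \<Phi>_def using p_lower by (intro sum_mono) (auto simp: cell_def)
    finally show ?thesis .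
  qed
  have q_upper: "q i \<le> (1 + \<epsilon>) * (cost i / \<Phi>)" for i
  proof -
    have "q i \<le> (\<Sum>x\<in>cell i. (1 + \<epsilon>) * (kmeans_cost {x} C / \<Phi>))"
      unfolding q_def \<Phi>_def using p_upper by (intro sum_mono) (auto simp: cell_def)
    also have "\<dots> = (1 + \<epsilon>) * (cost i / \<Phi>)"
      unfolding cost_def kmeans_cost_eq_sum[of "cell i"]
      by (simp add: sum_distrib_left sum_divide_distrib)
    finally show ?thesis .
  qed
  \<comment> \<open>The upper sampling bound is used for single points, the lower one for the mass
    of the whole cell; together they cost one factor \<open>R\<close>.\<close>
  have hit: "(\<Sum>x\<in>cell i. p x * kmeans_cost (cell i) (insert x C)) \<le> 8 * R * center_cost i * q i" for i
  proof -
    have "(\<Sum>x\<in>cell i. p x * kmeans_cost (cell i) (insert x C))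
      \<le> (\<Sum>x\<in>cell i. (1 + \<epsilon>) * (kmeans_cost {x} C / \<Phi>) * kmeans_cost (cell i) (insert x C))"
      using p_upper C unfolding \<Phi>_def
      by (intro sum_mono mult_right_mono kmeans_cost_nonneg) (auto simp: cell_def)
    also have "\<dots> = (1 + \<epsilon>) / \<Phi> * (\<Sum>x\<in>cell i. kmeans_cost {x} C * kmeans_cost (cell i) (insert x C))"
      by (simp add: sum_distrib_left mult.assoc)
    also have "\<dots> \<le> (1 + \<epsilon>) / \<Phi> * (8 * cost i * center_cost i)"
      unfolding cost_def center_cost_def using \<Phi> eps_nonneg C
      by (intro mult_left_mono D2_seeding_cost finite_cell) auto
    also have "\<dots> = 8 * R * center_cost i * ((1 - \<epsilon>) * (cost i / \<Phi>))"
      unfolding one_plus_eps by simp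
    also have "\<dots> \<le> 8 * R * center_cost i * q i"
      using R_ge_1 center_cost_nonneg[of i] by (intro mult_left_mono q_lower) auto
    finally show ?thesis .
  qed
  \<comment> \<open>If \<open>cost j\<close> is at least \<open>R * cost i\<close>, the lower bound
    on \<open>q j\<close> reaches the upper bound on \<open>q i\<close>. This is where the gap
    \<open>R\<close> in the layer ratio is used.\<close>
  have removal: "(\<Sum>i\<in>U. q i * envelope C (U - {i})) \<le> q\<^sub>U * V"
    unfolding q\<^sub>U_def V_def envelope_def
  proof (rule layer_mean_removal[OF finU q_nn _ R_ge_1])
    fix i j assume "R * kmeans_cost (cell i) C \<le> kmeans_cost (cell j) C"
    then have "R * cost i / \<Phi> \<le> cost j / \<Phi>" using \<Phi> by (simp add: cost_def divide_right_mono)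
    then have "(1 - \<epsilon>) * (R * cost i / \<Phi>) \<le> (1 - \<epsilon>) * (cost j / \<Phi>)"
      using eps_less_1 by (intro mult_left_mono) auto
    then show "q i \<le> q j" using q_upper[of i] q_lower[of j] by (simp add: one_plus_eps mult_ac)
  qed (simp add: nn)
  have miss: "p x * potential t (insert x C) \<le> p x * (a * hf u + (m + 1) * V)"
    if "x \<in> X" "s x \<in> s ` C" for x
  proof (intro mult_left_mono p_nonneg that)
    have unc: "uncovered (insert x C) = U"
      using that by (auto simp: U_def uncovered_def)
    have "settled_cost (insert x C) * hf u \<le> a * hf u"
      unfolding a_def using settled_cost_insert_covered[OF C(1,2) that(2)] hf_ge[of u]
      by (intro mult_right_mono) auto
    \<comment> \<open>A miss uses up a round but covers no cell, so the coefficient grows by at most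
      1; truncation makes it stay 0 if \<open>u \<le> t\<close>.\<close>
    moreover have "real (u - t) * envelope (insert x C) U \<le> (m + 1) * V"
      using envelope_insert_le[OF C(1,2) finU] m_nn unfolding V_def
      by (intro mult_mono) (auto simp: m_def envelope_def layer_mean_nonneg)
    ultimately show "potential t (insert x C) \<le> a * hf u + (m + 1) * V"
      by (simp add: potential_def unc hf_def u_def)
  qed
  have hitpot: "(\<Sum>x\<in>cell i. p x * potential t (insert x C))
      \<le> q i * (a * hf (u - 1)) + m * (q i * envelope C (U - {i}))" if i: "i \<in> U" for i
  proof -
    define b where "b x = a - 8 * R * center_cost i + kmeans_cost (cell i) (insert x C)" for x
    have "p x * potential t (insert x C) \<le> p x * (b x * hf (u - 1) + m * envelope C (U - {i}))"
      if x: "x \<in> cell i" for x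
    proof (intro mult_left_mono p_nonneg)
      have sx: "s x = i" and "x \<in> X" using x by (auto simp: cell_def)
      then show "x \<in> X" by simp
      have unc: "uncovered (insert x C) = U - {i}" by (simp add: uncovered_insert sx U_def)
      have card: "card (U - {i}) = u - 1" using i finU by (simp add: u_def)
      have "settled_cost (insert x C) * hf (u - 1) \<le> b x * hf (u - 1)"
        unfolding b_def a_def using settled_cost_insert_uncovered[OF C(1,2), of x] i hf_ge[of "u - 1"]
        by (intro mult_right_mono) (auto simp: sx U_def)
      \<comment> \<open>A hit uses up a round and covers a cell, so the coefficient remains
        \<open>m\<close>.\<close>
      moreover have "real (u - 1 - t) * envelope (insert x C) (U - {i}) \<le> m * envelope C (U - {i})"
        using envelope_insert_le[OF C(1,2), of "U - {i}" x] finU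
        by (intro mult_mono) (auto simp: m_def envelope_def layer_mean_nonneg)
      ultimately show "potential t (insert x C) \<le> b x * hf (u - 1) + m * envelope C (U - {i})"
        by (simp add: potential_def unc card hf_def)
    qed
    then have "(\<Sum>x\<in>cell i. p x * potential t (insert x C))
      \<le> (\<Sum>x\<in>cell i. p x * (b x * hf (u - 1) + m * envelope C (U - {i})))" by (rule sum_mono)
    also have "\<dots> = (\<Sum>x\<in>cell i. p x * b x) * hf (u - 1) + m * (q i * envelope C (U - {i}))"
      by (simp add: q_def algebra_simps sum.distrib sum_distrib_left sum_distrib_right)
    also have "(\<Sum>x\<in>cell i. p x * b x)
      = q i * a - q i * (8 * R * center_cost i) + (\<Sum>x\<in>cell i. p x * kmeans_cost (cell i) (insert x C))"
      by (simp add: b_def q_def algebra_simps sum.distrib sum_subtractf sum_distrib_left sum_distrib_right)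
    also have "\<dots> \<le> q i * a" using hit[of i] by (simp add: mult_ac)
    finally show ?thesis using hf_ge[of "u - 1"] by (simp add: mult_right_mono mult.assoc)
  qed
  have "(\<Sum>x\<in>X. p x * potential t (insert x C))
    = (\<Sum>i\<in>s ` C. \<Sum>x\<in>cell i. p x * potential t (insert x C))
      + (\<Sum>i\<in>U. \<Sum>x\<in>cell i. p x * potential t (insert x C))"
    unfolding U_def by (rule sum_cells[OF C(3)])
  also have "(\<Sum>i\<in>s ` C. \<Sum>x\<in>cell i. p x * potential t (insert x C))
    \<le> (\<Sum>i\<in>s ` C. \<Sum>x\<in>cell i. p x * (a * hf u + (m + 1) * V))"
    by (intro sum_mono miss) (auto simp: cell_def)
  also have "\<dots> = q\<^sub>0 * (a * hf u + (m + 1) * V)"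
    by (simp add: q\<^sub>0_def q_def sum_distrib_right)
  also have "(\<Sum>i\<in>U. \<Sum>x\<in>cell i. p x * potential t (insert x C))
    \<le> (\<Sum>i\<in>U. q i * (a * hf (u - 1)) + m * (q i * envelope C (U - {i})))"
    by (intro sum_mono hitpot)
  also have "\<dots> = q\<^sub>U * (a * hf (u - 1)) + m * (\<Sum>i\<in>U. q i * envelope C (U - {i}))"
    by (simp add: q\<^sub>U_def sum.distrib sum_distrib_left sum_distrib_right)
  also have "\<dots> \<le> q\<^sub>U * (a * hf (u - 1)) + m * (q\<^sub>U * V)"
    using removal m_nn by (simp add: mult_left_mono)
  \<comment> \<open>Split off what remains after the main term: the charge
    \<open>q\<^sub>0 * V\<close> for misses against the harmonic saving on hits.\<close>
  also have "q\<^sub>0 * (a * hf u + (m + 1) * V) + (q\<^sub>U * (a * hf (u - 1)) + m * (q\<^sub>U * V))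
    = (q\<^sub>0 + q\<^sub>U) * (a * hf u + m * V) + (q\<^sub>0 * V - q\<^sub>U * a * (hf u - hf (u - 1)))"
    by (simp add: algebra_simps)
  also have "\<dots> \<le> a * hf u + m * V"
  proof -
    have "q\<^sub>0 * V \<le> q\<^sub>U * a * (hf u - hf (u - 1))"
    proof (cases "u = 0")
      \<comment> \<open>For the empty set the layer ratio is \<open>0 / 0 = 0\<close>, hence
        \<open>V = 0\<close>; also \<open>u - 1 = u\<close> by truncation.\<close>
      case True
      then have "U = {}" using finU by (simp add: u_def)
      then have "V = 0" by (simp add: V_def envelope_def layer_mean_def layer_ratio_def)
      then show ?thesis using True by simp
    next
      case False
      then have u: "real u > 0" by simp
      have hfd: "hf u - hf (u - 1) = R\<^sup>2 / real u"
        using False by (cases u) (auto simp: hf_def harm_Suc field_simps)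
      have "q\<^sub>0 \<le> (\<Sum>i\<in>s ` C. (1 + \<epsilon>) * (cost i / \<Phi>))"
        unfolding q\<^sub>0_def by (intro sum_mono q_upper)
      also have "\<dots> = (1 + \<epsilon>) / \<Phi> * (\<Sum>i\<in>s ` C. cost i)" by (simp add: sum_distrib_left)
      also have "\<dots> \<le> (1 + \<epsilon>) / \<Phi> * a" using a_ge eps_nonneg \<Phi> by (intro mult_left_mono) auto
      finally have 1: "q\<^sub>0 \<le> (1 + \<epsilon>) / \<Phi> * a" .
      have 2: "V \<le> R * (sum cost U / real u)"
        unfolding V_def envelope_def u_def cost_def
        using finU R_ge_1 nn by (intro layer_mean_bounds) auto
      have "(1 - \<epsilon>) / \<Phi> * sum cost U = (\<Sum>i\<in>U. (1 - \<epsilon>) * (cost i / \<Phi>))" by (simp add: sum_distrib_left)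
      also have "\<dots> \<le> q\<^sub>U" unfolding q\<^sub>U_def by (intro sum_mono q_lower)
      finally have 3: "(1 - \<epsilon>) / \<Phi> * sum cost U \<le> q\<^sub>U" .
      \<comment> \<open>One factor \<open>R\<close> comes from the odds of a miss and one from the
        envelope; this fixes the coefficient \<open>R\<^sup>2\<close> of the harmonic
        number.\<close>
      have "q\<^sub>0 * V \<le> (1 + \<epsilon>) / \<Phi> * a * (R * (sum cost U / real u))"
        using 1 2 V_nn a_nn \<Phi> eps_nonneg by (intro mult_mono) auto
      also have "\<dots> = (1 - \<epsilon>) / \<Phi> * sum cost U * (a * (R\<^sup>2 / real u))"
        unfolding one_plus_eps by (simp add: power2_eq_square)
      also have "\<dots> \<le> q\<^sub>U * (a * (R\<^sup>2 / real u))"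
        using 3 a_nn by (intro mult_right_mono) auto
      finally show ?thesis unfolding hfd by (simp add: mult.assoc)
    qed
    then show ?thesis using total by simp
  qed
  finally show ?thesis
    by (simp add: potential_def hf_def m_def V_def u_def U_def a_def)
qed

text \<open>Start from all cells pre-charged. The cell that is hit exchanges its pre-charge for a
  cost of no larger expectation, and enough rounds are left for the envelope term to vanish.\<close>

lemma potential_first_step:
  assumes p_lower: "\<And>x. x \<in> X \<Longrightarrow> (1 - \<epsilon>) / real (card X) \<le> p x"
    and p_upper: "\<And>x. x \<in> X \<Longrightarrow> p x \<le> (1 + \<epsilon>) / real (card X)"
    and p_sum: "(\<Sum>x\<in>X. p x) = 1"
    and t: "card (s ` X) \<le> Suc t"
  shows "(\<Sum>x\<in>X. p x * potential t {x})
    \<le> 8 * R * (\<Sum>x\<in>X. (norm (x - s x))\<^sup>2) * (1 + R\<^sup>2 * harm (card (s ` X) - 1))"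
proof -
  define n where "n = real (card X)"
  define q where "q i = (\<Sum>x\<in>cell i. p x)" for i
  define K where "K = 8 * R * (\<Sum>i\<in>s ` X. center_cost i)"
  define f where "f = 1 + R\<^sup>2 * (harm (card (s ` X) - 1) :: real)"
  have f: "1 \<le> f" unfolding f_def by (rule harm_factor_ge_1)
  have sumX: "(\<Sum>x\<in>X. g x) = (\<Sum>i\<in>s ` X. \<Sum>x\<in>cell i. g x)" for g :: "'a \<Rightarrow> real"
    using sum_cells[of X g] by (simp add: uncovered_def)
  have q_lower: "(1 - \<epsilon>) / n * real (card (cell i)) \<le> q i" for i
    using sum_mono[of "cell i" "\<lambda>_. (1 - \<epsilon>) / n" p] p_lower
    by (auto simp: q_def n_def cell_def mult.commute)
  have hit: "(\<Sum>x\<in>cell i. p x * kmeans_cost (cell i) {x}) \<le> 8 * R * center_cost i * q i" for i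
  proof -
    have "(\<Sum>x\<in>cell i. p x * kmeans_cost (cell i) {x})
      \<le> (\<Sum>x\<in>cell i. (1 + \<epsilon>) / n * kmeans_cost (cell i) {x})"
      using p_upper unfolding n_def
      by (intro sum_mono mult_right_mono kmeans_cost_nonneg) (auto simp: cell_def)
    also have "\<dots> = (1 + \<epsilon>) / n * (\<Sum>a\<in>cell i. \<Sum>x\<in>cell i. (norm (x - a))\<^sup>2)"
      by (simp add: kmeans_cost_def sum_distrib_left)
    also have "\<dots> \<le> (1 + \<epsilon>) / n * (2 * real (card (cell i)) * center_cost i)"
      unfolding center_cost_def using eps_nonneg
      by (intro mult_left_mono sum_pairwise_dist_le) (auto simp: n_def)
    also have "\<dots> = 2 * R * center_cost i * ((1 - \<epsilon>) / n * real (card (cell i)))"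
      unfolding one_plus_eps by simp
    also have "\<dots> \<le> 2 * R * center_cost i * q i"
      using R_ge_1 center_cost_nonneg[of i] by (intro mult_left_mono q_lower) auto
    \<comment> \<open>A nearly uniform draw costs only the factor \<open>2 * R\<close>; it is
      relaxed to match the pre-charge of the later rounds.\<close>
    also have "\<dots> \<le> 8 * R * center_cost i * q i"
    proof -
      have "0 \<le> (1 - \<epsilon>) / n * real (card (cell i))" using eps_less_1 by (simp add: n_def)
      then have "0 \<le> q i" using q_lower[of i] by linarith
      then show ?thesis using R_ge_1 center_cost_nonneg[of i] by (intro mult_right_mono) auto
    qed
    finally show ?thesis .
  qed
  have inner: "(\<Sum>x\<in>cell i. p x * potential t {x}) \<le> q i * K * f" if i: "i \<in> s ` X" for i
  proof -
    have "potential t {x} = (K - 8 * R * center_cost i + kmeans_cost (cell i) {x}) * f"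
      if x: "x \<in> cell i" for x
    proof -
      have sx: "s x = i" using x by (simp add: cell_def)
      have unc: "uncovered {x} = s ` X - {i}" by (simp add: uncovered_def sx)
      have card: "card (s ` X - {i}) = card (s ` X) - 1" using i finite_X by simp
      \<comment> \<open>At most \<open>t\<close> cells are still uncovered, so the truncated
        coefficient of the envelope is 0.\<close>
      have z: "card (s ` X) - 1 - t = 0" using t by simp
      show ?thesis
        unfolding potential_def settled_cost_def unc card z f_def K_def using i finite_X
        by (simp add: sx sum_diff1 algebra_simps)
    qed
    then have "(\<Sum>x\<in>cell i. p x * potential t {x})
      = (\<Sum>x\<in>cell i. p x * ((K - 8 * R * center_cost i + kmeans_cost (cell i) {x}) * f))"
      by (intro sum.cong) auto
    also have "\<dots> = (q i * K - 8 * R * center_cost i * q i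
        + (\<Sum>x\<in>cell i. p x * kmeans_cost (cell i) {x})) * f"
      by (simp add: q_def algebra_simps sum.distrib sum_subtractf sum_distrib_left sum_distrib_right)
    also have "\<dots> \<le> q i * K * f" using hit[of i] f by (intro mult_right_mono) auto
    finally show ?thesis .
  qed
  have K: "K = 8 * R * (\<Sum>x\<in>X. (norm (x - s x))\<^sup>2)"
    unfolding K_def center_cost_def sumX by (simp add: cell_def)
  have "(\<Sum>x\<in>X. p x * potential t {x}) \<le> (\<Sum>i\<in>s ` X. q i * K * f)"
    unfolding sumX by (intro sum_mono inner)
  also have "\<dots> = (\<Sum>i\<in>s ` X. q i) * K * f" by (simp add: sum_distrib_right)
  also have "(\<Sum>i\<in>s ` X. q i) = 1" using p_sum sumX[of p] by (simp add: q_def)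
  finally show ?thesis by (simp add: K f_def)
qed

section \<open>Expectation over whole runs\<close>

lemma sample_history_support:
  assumes rule: "noisy_sampling_rule \<epsilon> X k q" and "j \<le> k"
  shows "set_pmf (sample_history q j) \<subseteq> {h. set h \<subseteq> X \<and> length h = j}"
  using \<open>j \<le> k\<close>
proof (induction j)
  case (Suc j)
  have "set_pmf (q h) \<subseteq> X" if "h \<in> set_pmf (sample_history q j)" for h
  proof (cases "j = 0")
    case True
    then show ?thesis using rule that by (simp add: noisy_sampling_rule_def)
  next
    case False
    then show ?thesis using noisy_sampling_rule_later(1)[OF rule _ _ that] Suc.prems by simp
  qed
  then show ?case using Suc by (fastforce simp: set_bind_pmf)
qed simp

lemma finite_sample_history_support:
  assumes "noisy_sampling_rule \<epsilon> X k q" "j \<le> k"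
  shows "finite (set_pmf (sample_history q j))"
  using sample_history_support[OF assms] finite_lists_length_eq[OF finite_X, of j]
  by (rule finite_subset)

lemma expectation_eq_sum:
  fixes f :: "'a \<Rightarrow> real"
  assumes "set_pmf p \<subseteq> X"
  shows "measure_pmf.expectation p f = (\<Sum>x\<in>X. pmf p x * f x)"
  using assms finite_X by (subst integral_measure_pmf[of X]) auto

text \<open>Induction on the number of samples drawn: the first round gives the bound, and every
  later round preserves it conditionally on the history.\<close>

lemma expected_potential_le:
  assumes rule: "noisy_sampling_rule \<epsilon> X k q" and card: "card (s ` X) \<le> k" and j: "1 \<le> j" "j \<le> k"
  shows "measure_pmf.expectation (sample_history q j) (\<lambda>h. potential (k - j) (set h))
    \<le> 8 * R * (\<Sum>x\<in>X. (norm (x - s x))\<^sup>2) * (1 + R\<^sup>2 * harm (card (s ` X) - 1))"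
  using j
proof (induction j rule: dec_induct)
  case base
  have q: "set_pmf (q []) \<subseteq> X" using rule by (simp add: noisy_sampling_rule_def)
  have "measure_pmf.expectation (sample_history q 1) (\<lambda>h. potential (k - 1) (set h))
    = (\<Sum>x\<in>X. pmf (q []) x * potential (k - 1) {x})"
    by (simp add: bind_return_pmf expectation_eq_sum[OF q])
  also have "\<dots> \<le> 8 * R * (\<Sum>x\<in>X. (norm (x - s x))\<^sup>2) * (1 + R\<^sup>2 * harm (card (s ` X) - 1))"
    using rule card finite_X q
    by (intro potential_first_step sum_pmf_eq_1) (auto simp: noisy_sampling_rule_def)
  finally show ?case by simp
next
  case (step j)
  let ?H = "sample_history q j"
  have fin: "finite (set_pmf ?H)" using rule step by (intro finite_sample_history_support) auto
  have h: "set h \<subseteq> X" "h \<noteq> []" if "h \<in> set_pmf ?H" for h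
    using step that sample_history_support[OF rule, of j] by auto
  have "1 \<le> j" "j < k" using step by auto
  note later = noisy_sampling_rule_later[OF rule this]
  \<comment> \<open>Condition on the history \<open>h\<close>: it determines the distribution
    \<open>q h\<close> chosen by the adaptive adversary.\<close>
  have "measure_pmf.expectation (sample_history q (Suc j)) (\<lambda>h. potential (k - Suc j) (set h))
    = (\<Sum>h\<in>set_pmf ?H. pmf ?H h * measure_pmf.expectation (q h) (\<lambda>x. potential (k - Suc j) (insert x (set h))))"
    using fin later(1) finite_X by (simp, subst pmf_expectation_bind[of "set_pmf ?H"]) (auto intro: finite_subset)
  also have "\<dots> \<le> (\<Sum>h\<in>set_pmf ?H. pmf ?H h * potential (k - j) (set h))"
  proof (intro sum_mono mult_left_mono)
    fix h assume hH: "h \<in> set_pmf ?H"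
    have "k - j = Suc (k - Suc j)" using step by simp
    then show "measure_pmf.expectation (q h) (\<lambda>x. potential (k - Suc j) (insert x (set h)))
      \<le> potential (k - j) (set h)"
      unfolding expectation_eq_sum[OF later(1)[OF hH]] using h[OF hH] later[OF hH] finite_X
      by (simp only:) (intro potential_step sum_pmf_eq_1, auto)
  qed simp
  also have "\<dots> = measure_pmf.expectation ?H (\<lambda>h. potential (k - j) (set h))"
    using fin by (subst integral_measure_pmf[of "set_pmf ?H"]) auto
  finally show ?case using step by simp
qed

lemma expected_cost_le:
  assumes rule: "noisy_sampling_rule \<epsilon> X k q" and card: "card (s ` X) \<le> k" and k: "1 \<le> k"
  shows "measure_pmf.expectation (noisy_kmeanspp q k) (\<lambda>C. kmeans_cost X C)
    \<le> 8 * R * (\<Sum>x\<in>X. (norm (x - s x))\<^sup>2) * (1 + R\<^sup>2 * harm (card (s ` X) - 1))"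
proof -
  have int: "integrable (measure_pmf (sample_history q k)) f" for f :: "'a list \<Rightarrow> real"
    using finite_sample_history_support[OF rule] by (intro integrable_measure_pmf_finite) auto
  have "measure_pmf.expectation (noisy_kmeanspp q k) (\<lambda>C. kmeans_cost X C)
    = measure_pmf.expectation (sample_history q k) (\<lambda>h. kmeans_cost X (set h))"
    by (simp add: noisy_kmeanspp_def)
  also have "\<dots> \<le> measure_pmf.expectation (sample_history q k) (\<lambda>h. potential (k - k) (set h))"
  proof (intro integral_mono_AE int AE_pmfI)
    fix h assume "h \<in> set_pmf (sample_history q k)"
    then have "set h \<subseteq> X" "h \<noteq> []" using sample_history_support[OF rule, of k] k by auto
    then show "kmeans_cost X (set h) \<le> potential (k - k) (set h)"
      by (simp add: cost_le_potential_0)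
  qed
  also have "\<dots> \<le> 8 * R * (\<Sum>x\<in>X. (norm (x - s x))\<^sup>2) * (1 + R\<^sup>2 * harm (card (s ` X) - 1))"
    using rule card k by (intro expected_potential_le) auto
  finally show ?thesis .
qed

end

section \<open>Comparison with fixed centers and with the optimum\<close>

lemma expected_cost_le_centers:
  fixes X :: "'a::euclidean_space set"
  assumes X: "finite X" and k: "1 \<le> k" and eps: "0 \<le> \<epsilon>" "\<epsilon> < 1"
    and rule: "noisy_sampling_rule \<epsilon> X k q"
    and C: "finite C" "card C = k"
  shows "measure_pmf.expectation (noisy_kmeanspp q k) (\<lambda>C. kmeans_cost X C)
    \<le> 8 * (ln (real k) + 2) * ((1 + \<epsilon>) / (1 - \<epsilon>)) ^ 4 * kmeans_cost X C"
proof -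
  have C0: "C \<noteq> {}" using C k by auto
  \<comment> \<open>A choice of nearest centers makes the cells a Voronoi partition with total
    center cost \<open>kmeans_cost X C\<close>; there are at most \<open>k\<close> of them, since
    some centers may own no point.\<close>
  have "\<exists>c\<in>C. kmeans_cost {x} C = (norm (x - c))\<^sup>2" for x
    using kmeans_cost_point_attained[OF C(1) C0] by metis
  then obtain s where s: "\<And>x. s x \<in> C" "\<And>x. kmeans_cost {x} C = (norm (x - s x))\<^sup>2" by metis
  define r where "r = noise_ratio \<epsilon>"
  define n where "n = card (s ` X) - 1"
  have r: "1 \<le> r" unfolding r_def using eps by (rule noise_ratio_ge_1)
  interpret noisy_seeding X s \<epsilon> using X eps by unfold_locales
  have "card (s ` X) \<le> card C" using s C by (intro card_mono) auto
  then have card: "card (s ` X) \<le> k" using C by simp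
  have cost: "(\<Sum>x\<in>X. (norm (x - s x))\<^sup>2) = kmeans_cost X C"
    by (simp add: kmeans_cost_eq_sum[of X] s)
  have nn: "0 \<le> kmeans_cost X C" using C C0 by (simp add: kmeans_cost_nonneg)
  \<comment> \<open>The case \<open>n = 0\<close> (a single cell) is separate because the
    logarithmic bound requires \<open>n \<ge> 1\<close>.\<close>
  have harm: "harm n \<le> ln (real k) + 1"
  proof (cases "n = 0")
    case True
    then show ?thesis using k by (simp add: harm_def)
  next
    case False
    then have "harm n \<le> ln (real n) + 1" by (intro harm_le_ln_plus_1) simp
    also have "ln (real n) \<le> ln (real k)" using False card by (subst ln_le_cancel_iff) (auto simp: n_def)
    finally show ?thesis by simp
  qed
  have "r * (1 + r\<^sup>2 * harm n) \<le> r * (r\<^sup>2 * (1 + harm n))"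
    using r one_le_power[OF r, of 2] by (intro mult_left_mono) (auto simp: algebra_simps)
  also have "\<dots> = r ^ 3 * (1 + harm n)" by (simp add: power3_eq_cube power2_eq_square)
  \<comment> \<open>The argument yields the exponent 3, which \<open>r \<ge> 1\<close> relaxes to
    4.\<close>
  also have "\<dots> \<le> r ^ 4 * (ln (real k) + 2)"
    using harm r harm_nonneg[of n, where 'a=real] by (intro mult_mono power_increasing) auto
  finally have r_le: "r * (1 + r\<^sup>2 * harm n) \<le> r ^ 4 * (ln (real k) + 2)" .
  have "measure_pmf.expectation (noisy_kmeanspp q k) (\<lambda>C. kmeans_cost X C)
      \<le> 8 * kmeans_cost X C * (r * (1 + r\<^sup>2 * harm n))"
    using expected_cost_le[OF rule card k] unfolding cost r_def[symmetric] n_def[symmetric]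
    by (simp only: mult_ac)
  also have "\<dots> \<le> 8 * kmeans_cost X C * (r ^ 4 * (ln (real k) + 2))"
    using nn by (intro mult_left_mono r_le) auto
  finally show ?thesis
    unfolding noise_ratio_def[symmetric] r_def[symmetric] by (simp only: mult_ac)
qed

theorem theorem1p1:
  fixes X :: "(real ^ 'd) set" and k :: nat and \<epsilon> :: real
  assumes "finite X" and "X \<noteq> {}"
    and "1 \<le> k" and "k \<le> card X"
    and "0 \<le> \<epsilon>" and "\<epsilon> < 1"
  shows "(\<forall>q. noisy_sampling_rule \<epsilon> X k q \<longrightarrow>
            measure_pmf.expectation (noisy_kmeanspp q k) (\<lambda>C. kmeans_cost X C)
              \<le> 8 * (ln (real k) + 2) * ((1 + \<epsilon>) / (1 - \<epsilon>)) ^ 4 * opt_cost k X) \<and>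
         (\<epsilon> < 1 / 2 \<longrightarrow> ((1 + \<epsilon>) / (1 - \<epsilon>)) ^ 4 \<le> 1 + 160 * \<epsilon>)"
proof (intro conjI allI impI)
  fix q assume rule: "noisy_sampling_rule \<epsilon> X k q"
  define K where "K = 8 * (ln (real k) + 2) * ((1 + \<epsilon>) / (1 - \<epsilon>)) ^ 4"
  have "0 \<le> ln (real k)" using assms(3) by simp
  then have K: "0 < K" using assms(5,6) unfolding K_def by (intro mult_pos_pos zero_less_power) auto
  let ?E = "measure_pmf.expectation (noisy_kmeanspp q k) (\<lambda>C. kmeans_cost X C)"
  \<comment> \<open>Dividing by \<open>K > 0\<close> makes the left side a lower bound for all costs
    over which the infimum is taken.\<close>
  have "?E / K \<le> opt_cost k X"
    unfolding opt_cost_def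
  proof (rule cINF_greatest)
    \<comment> \<open>A \<open>k\<close>-element subset of \<open>X\<close> shows that this infimum
      is over a nonempty set.\<close>
    obtain C where "C \<subseteq> X" "card C = k"
      using obtain_subset_with_card_n[OF assms(4)] by blast
    then show "{C::(real^'d) set. finite C \<and> card C = k} \<noteq> {}"
      using assms(1) finite_subset by blast
  next
    fix C :: "(real^'d) set" assume "C \<in> {C. finite C \<and> card C = k}"
    then have "?E \<le> K * kmeans_cost X C"
      unfolding K_def using assms rule by (intro expected_cost_le_centers) auto
    then show "?E / K \<le> kmeans_cost X C" using K by (simp add: divide_le_eq mult.commute)
  qed
  then show "?E \<le> 8 * (ln (real k) + 2) * ((1 + \<epsilon>) / (1 - \<epsilon>)) ^ 4 * opt_cost k X"
    using K unfolding K_def[symmetric] by (simp add: divide_le_eq mult.commute)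
qed (use assms noise_ratio_power4_le in auto)

end
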